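(* The inequality $$\left| f\big(a+q^{m}(b-a)\big)-\frac{1}{b-a}\int_a^b f(t)\,d_q^a t\right| \le (b-a)\left(\frac{1+2q^{2m+1}}{1+q}-q^{m}\right)\left\|D_q^a f\right\|_\infty^{(a,b]},$$ valid for all functions $f:[a,b]\to\mathbb{R}$ that are $q$-integrable over $[a,b]$ and all integers $m\ge0$, is sharp for every $q\in(0,1)$. That is, for every $q\in(0,1)$, all real $a<b$ and every integer $m\ge 0$, there exists a $q$-integrable function $f:[a,b]\to\mathbb{R}$ with $0<\|D_q^a f\|_\infty^{(a,b]}<\infty$ for which equality holds.
   Context: Let $f:[a,b]\to\mathbb{R}$ and $q\in(0,1)$. The (shifted) $q$-derivative of $f$ at $x\in(a,b]$ is $$D_q^a f(x)=\frac{f(x)-f(a+q(x-a))}{(1-q)(x-a)}.$$ The (shifted) $q$-integral is $$\int_a^b f(t)\,d_q^a t=(1-q)(b-a)\sum_{k=0}^\infty q^k f\big(a+q^k(b-a)\big),$$ and $f$ is called $q$-integrable over $[a,b]$ if this series converges. For a function $g$ defined on $(a,b]$, $\|g\|_\infty^{(a,b]}=\sup_{t\in(a,b]}|g(t)|\in[0,+\infty]$; if this is $+\infty$ the inequality is understood to hold trivially. *)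

theory Defs
  imports Complex_Main "HOL-Library.Extended_Real"
begin

text \<open>
  A function on \<open>[a, b]\<close> is represented by a total function on the reals. For \<open>0 < q < 1\<close> and
  \<open>x\<close> in \<open>(a, b]\<close> the definitions below evaluate it only at points of \<open>(a, b]\<close>.
\<close>

definition q_deriv :: "real \<Rightarrow> real \<Rightarrow> (real \<Rightarrow> real) \<Rightarrow> real \<Rightarrow> real" where
  "q_deriv q a f x = (f x - f (a + q * (x - a))) / ((1 - q) * (x - a))"

definition q_integrable :: "real \<Rightarrow> real \<Rightarrow> real \<Rightarrow> (real \<Rightarrow> real) \<Rightarrow> bool" where
  "q_integrable q a b f \<longleftrightarrow> summable (\<lambda>k. q ^ k * f (a + q ^ k * (b - a)))"

definition q_integral :: "real \<Rightarrow> real \<Rightarrow> real \<Rightarrow> (real \<Rightarrow> real) \<Rightarrow> real" where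
  "q_integral q a b f = (1 - q) * (b - a) * (\<Sum>k. q ^ k * f (a + q ^ k * (b - a)))"

text \<open>
  The supremum is taken in the extended reals, so it is \<open>\<infinity>\<close> for unbounded \<open>g\<close>. It lies in
  \<open>[0, \<infinity>]\<close> for \<open>a < b\<close>; for an empty interval it would be \<open>-\<infinity>\<close>.
\<close>

definition sup_norm_Ioc :: "real \<Rightarrow> real \<Rightarrow> (real \<Rightarrow> real) \<Rightarrow> ereal" where
  "sup_norm_Ioc a b g = (SUP t\<in>{a<..b}. ereal \<bar>g t\<bar>)"

end

(* On the grid x_k = a + q^k (b - a) a bound M on the q-derivative there says that f changes by at
   most M |x_k - x_(k+1)| between neighbours, so f is M-Lipschitz on the grid. The mean value of
   the q-integral is the average of f over the grid with weights (1 - q) q^k, which sum to 1; hence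
   the deviation from f (x_m) is at most M times the average of |x_k - x_m|. Equality holds
   for f t = |t - x_m|, whose q-derivative has modulus at most 1, and exactly 1 at b. *)
theory Submission
  imports Defs
begin

text \<open>This is where the constant comes from: times \<open>b - a\<close>, the sum is the
  weighted average of |x_k - x_m|. With the sign that is right for k >= m, the series is a
  difference of geometric series with ratios \<open>q\<close> and \<open>q ^ 2\<close>; a finite sum
  then corrects the earlier terms.\<close>

lemma sums_weighted_grid_distance:
  fixes q :: real
  assumes q: "0 < q" "q < 1"
  shows "(\<lambda>k. (1 - q) * q ^ k * \<bar>q ^ k - q ^ m\<bar>) sums ((1 + 2 * q ^ (2 * m + 1)) / (1 + q) - q ^ m)"
proof -
  have q2: "q ^ 2 < 1"
    using q by (simp add: power_less_one_iff)
  have nz: "1 - q \<noteq> 0" "1 + q \<noteq> 0" "1 - q ^ 2 \<noteq> 0"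
    using q q2 by auto
  have "(\<lambda>k. (1 - q) * (q ^ m * q ^ k - (q ^ 2) ^ k)) sums
          ((1 - q) * (q ^ m * (1 / (1 - q)) - 1 / (1 - q ^ 2)))"
    using q q2 by (intro sums_mult sums_diff geometric_sums) auto
  moreover have "(1 - q) * (q ^ m * (1 / (1 - q)) - 1 / (1 - q ^ 2)) = q ^ m - 1 / (1 + q)"
  proof -
    have "1 - q ^ 2 = (1 - q) * (1 + q)"
      by (simp add: algebra_simps power2_eq_square)
    then show ?thesis
      using nz by (simp add: right_diff_distrib)
  qed
  ultimately have "(\<lambda>k. (1 - q) * (q ^ m * q ^ k - (q ^ 2) ^ k)) sums (q ^ m - 1 / (1 + q))"
    by simp
  \<comment> \<open>dropping the absolute value gives the wrong sign exactly for the terms with \<open>k < m\<close>\<close>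
  moreover have "(\<lambda>k. if k \<in> {..<m} then 2 * (1 - q) * ((q ^ 2) ^ k - q ^ m * q ^ k) else 0) sums
          (\<Sum>k<m. 2 * (1 - q) * ((q ^ 2) ^ k - q ^ m * q ^ k))"
    by (intro sums_If_finite_set) simp
  ultimately have "(\<lambda>k. (1 - q) * (q ^ m * q ^ k - (q ^ 2) ^ k) +
           (if k \<in> {..<m} then 2 * (1 - q) * ((q ^ 2) ^ k - q ^ m * q ^ k) else 0)) sums
          (q ^ m - 1 / (1 + q) + (\<Sum>k<m. 2 * (1 - q) * ((q ^ 2) ^ k - q ^ m * q ^ k)))"
    by (rule sums_add)
  moreover have "(1 - q) * (q ^ m * q ^ k - (q ^ 2) ^ k) +
      (if k \<in> {..<m} then 2 * (1 - q) * ((q ^ 2) ^ k - q ^ m * q ^ k) else 0)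
      = (1 - q) * q ^ k * \<bar>q ^ k - q ^ m\<bar>" for k
  proof -
    have sq: "(q ^ 2) ^ k = q ^ k * q ^ k"
      by (simp add: power2_eq_square power_mult_distrib)
    show ?thesis
    proof (cases "k < m")
      case True
      then have "\<bar>q ^ k - q ^ m\<bar> = q ^ k - q ^ m"
        using q by (simp add: power_decreasing)
      then show ?thesis
        using True by (simp add: sq algebra_simps)
    next
      case False
      then have "\<bar>q ^ k - q ^ m\<bar> = q ^ m - q ^ k"
        using q by (simp add: power_decreasing)
      then show ?thesis
        using False by (simp add: sq algebra_simps)
    qed
  qed
  moreover have "q ^ m - 1 / (1 + q) + (\<Sum>k<m. 2 * (1 - q) * ((q ^ 2) ^ k - q ^ m * q ^ k))
      = (1 + 2 * q ^ (2 * m + 1)) / (1 + q) - q ^ m"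
  proof -
    have "(\<Sum>k<m. 2 * (1 - q) * ((q ^ 2) ^ k - q ^ m * q ^ k))
        = 2 * ((1 - q) * (\<Sum>k<m. (q ^ 2) ^ k)) - 2 * q ^ m * ((1 - q) * (\<Sum>k<m. q ^ k))"
      by (simp only: sum_subtractf sum_distrib_left [symmetric]) (simp only: right_diff_distrib mult_ac)
    also have "(1 - q) * (\<Sum>k<m. q ^ k) = 1 - q ^ m"
      by (rule one_diff_power_eq [symmetric])
    also have "(1 - q) * (\<Sum>k<m. (q ^ 2) ^ k) = (1 - q ^ m * q ^ m) / (1 + q)"
    proof -
      have "(1 + q) * ((1 - q) * (\<Sum>k<m. (q ^ 2) ^ k)) = (1 - q ^ 2) * (\<Sum>k<m. (q ^ 2) ^ k)"
        by (simp add: algebra_simps power2_eq_square)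
      also have "\<dots> = 1 - (q ^ 2) ^ m"
        by (rule one_diff_power_eq [symmetric])
      also have "\<dots> = 1 - q ^ m * q ^ m"
        by (simp add: power2_eq_square power_mult_distrib)
      finally show ?thesis
        using nz by (simp add: field_simps)
    qed
    finally have sum_eq: "(\<Sum>k<m. 2 * (1 - q) * ((q ^ 2) ^ k - q ^ m * q ^ k))
        = 2 * ((1 - q ^ m * q ^ m) / (1 + q)) - 2 * q ^ m * (1 - q ^ m)" .
    \<comment> \<open>With \<open>q ^ m\<close> generalized to a free \<open>p\<close>, what remains
      is a rational identity in \<open>p\<close> and \<open>q\<close>, and no power laws interfere
      with clearing denominators.\<close>
    have "p - 1 / (1 + q) + (2 * ((1 - p * p) / (1 + q)) - 2 * p * (1 - p))
        = (1 + 2 * (q * (p * p))) / (1 + q) - p" for p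
      using nz(2) by (simp add: divide_simps) (simp add: algebra_simps)
    moreover have "q ^ (2 * m + 1) = q * (q ^ m * q ^ m)"
      by (simp add: mult_2 power_add)
    ultimately show ?thesis
      unfolding sum_eq by (simp only:)
  qed
  ultimately show ?thesis
    by (simp only:)
qed

text \<open>The constant is a sum of nonnegative terms that do not all vanish. Strict positivity
  matters when the norm is infinite, since 0 times infinity is 0 in \<open>ereal\<close>.\<close>

lemma ostrowski_constant_pos:
  fixes q :: real
  assumes q: "0 < q" "q < 1"
  shows "0 < (1 + 2 * q ^ (2 * m + 1)) / (1 + q) - q ^ m"
proof -
  note sums = sums_weighted_grid_distance [OF q, of m]
  have "0 < (\<Sum>k. (1 - q) * q ^ k * \<bar>q ^ k - q ^ m\<bar>)"
  \<comment> \<open>The term at \<open>m\<close> is zero; its successor is a nonzero one that exists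
    for every \<open>m\<close>.\<close>
  proof (rule suminf_pos2 [where i = "Suc m"])
    show "summable (\<lambda>k. (1 - q) * q ^ k * \<bar>q ^ k - q ^ m\<bar>)"
      using sums by (rule sums_summable)
    show "0 \<le> (1 - q) * q ^ k * \<bar>q ^ k - q ^ m\<bar>" for k
      using q by simp
    show "0 < (1 - q) * q ^ Suc m * \<bar>q ^ Suc m - q ^ m\<bar>"
      using q by simp
  qed
  then show ?thesis
    using sums_unique [OF sums] by simp
qed

lemma q_derivative_bound_grid_Lipschitz:
  fixes q :: real
  assumes q: "0 < q" "q < 1" and "a < b"
    and bound: "\<And>x. x \<in> {a<..b} \<Longrightarrow> \<bar>q_deriv q a f x\<bar> \<le> M"
  shows "\<bar>f (a + q ^ k * (b - a)) - f (a + q ^ m * (b - a))\<bar> \<le> M * (b - a) * \<bar>q ^ k - q ^ m\<bar>"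
proof -
  define y where "y k = f (a + q ^ k * (b - a))" for k
  have step: "\<bar>y k - y (Suc k)\<bar> \<le> M * (b - a) * (q ^ k - q ^ Suc k)" for k
  proof -
    define x where "x = a + q ^ k * (b - a)"
    have "q ^ k * (b - a) \<le> b - a"
      using q \<open>a < b\<close> by (intro mult_left_le_one_le power_le_one) auto
    then have "x \<le> b"
      unfolding x_def by linarith
    moreover have "a < x"
      using q \<open>a < b\<close> by (simp add: x_def)
    ultimately have x: "x \<in> {a<..b}"
      by simp
    \<comment> \<open>The map x to a + q (x - a) sends each grid point to the next, so the
      q-derivative at a grid point is the difference quotient between neighbours.\<close>
    have "(y k - y (Suc k)) = q_deriv q a f x * ((1 - q) * (x - a))"
      using q x by (simp add: q_deriv_def x_def y_def mult.assoc)
    then have "\<bar>y k - y (Suc k)\<bar> = \<bar>q_deriv q a f x\<bar> * ((1 - q) * (x - a))"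
      using q x by (simp add: abs_mult)
    also have "\<dots> \<le> M * ((1 - q) * (x - a))"
      using q x by (intro mult_right_mono bound) auto
    also have "\<dots> = M * (b - a) * (q ^ k - q ^ Suc k)"
      by (simp add: x_def algebra_simps)
    finally show ?thesis .
  qed
  \<comment> \<open>The grid is decreasing, so the bounds for single steps telescope with no loss;
    exchanging the two indices covers the other order.\<close>
  have le: "\<bar>y k - y (k + j)\<bar> \<le> M * (b - a) * (q ^ k - q ^ (k + j))" for k j
  proof (induction j)
    case (Suc j)
    show ?case
      using Suc step [of "k + j"] by (simp add: right_diff_distrib)
  qed simp
  have "\<bar>y k - y m\<bar> \<le> M * (b - a) * \<bar>q ^ k - q ^ m\<bar>"
  proof (cases "k \<le> m")
    case True
    then have "q ^ m \<le> q ^ k"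
      using q by (simp add: power_decreasing)
    then show ?thesis
      using le [of k "m - k"] True by simp
  next
    case False
    then have "q ^ k \<le> q ^ m"
      using q by (simp add: power_decreasing)
    then show ?thesis
      using le [of m "k - m"] False by (simp add: abs_minus_commute)
  qed
  then show ?thesis
    by (simp add: y_def)
qed

text \<open>A real bound \<open>M\<close> in place of the supremum keeps the estimate within real
  series; the extended reals enter only in the final theorem.\<close>

lemma q_Ostrowski_inequality:
  fixes q :: real
  assumes q: "0 < q" "q < 1" and "a < b" and int: "q_integrable q a b f"
    and bound: "\<And>x. x \<in> {a<..b} \<Longrightarrow> \<bar>q_deriv q a f x\<bar> \<le> M"
  shows "\<bar>f (a + q ^ m * (b - a)) - 1 / (b - a) * q_integral q a b f\<bar>
           \<le> (b - a) * ((1 + 2 * q ^ (2 * m + 1)) / (1 + q) - q ^ m) * M"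
proof -
  define y where "y k = f (a + q ^ k * (b - a))" for k
  define I where "I = (\<Sum>k. q ^ k * y k)"
  define C where "C = (1 + 2 * q ^ (2 * m + 1)) / (1 + q) - q ^ m"
  have "(\<lambda>k. q ^ k * y k) sums I"
    using int by (simp add: q_integrable_def I_def y_def summable_sums)
  moreover have "(\<lambda>k. q ^ k) sums (1 / (1 - q))"
    using q by (intro geometric_sums) simp
  \<comment> \<open>Because the weights sum to 1, the constant \<open>y m\<close> can be moved
    inside the average.\<close>
  ultimately have "(\<lambda>k. (1 - q) * (q ^ k * y k - q ^ k * y m)) sums
      ((1 - q) * (I - 1 / (1 - q) * y m))"
    by (intro sums_mult sums_diff sums_mult2)
  then have dev: "(\<lambda>k. (1 - q) * q ^ k * (y k - y m)) sums ((1 - q) * I - y m)"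
    using q by (simp only: right_diff_distrib mult.assoc) simp
  have bd: "(\<lambda>k. (M * (b - a)) * ((1 - q) * q ^ k * \<bar>q ^ k - q ^ m\<bar>)) sums (M * (b - a) * C)"
    unfolding C_def by (intro sums_mult sums_weighted_grid_distance q)
  have "norm ((1 - q) * q ^ k * (y k - y m))
      \<le> (M * (b - a)) * ((1 - q) * q ^ k * \<bar>q ^ k - q ^ m\<bar>)" for k
  proof -
    have "norm ((1 - q) * q ^ k * (y k - y m)) = (1 - q) * q ^ k * \<bar>y k - y m\<bar>"
      using q by (simp add: abs_mult)
    also have "\<dots> \<le> (1 - q) * q ^ k * (M * (b - a) * \<bar>q ^ k - q ^ m\<bar>)"
      unfolding y_def using q
      by (intro mult_left_mono q_derivative_bound_grid_Lipschitz bound \<open>a < b\<close>) auto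
    finally show ?thesis
      by (simp add: mult_ac)
  qed
  \<comment> \<open>Integrability gives mere convergence; the summable majorant \<open>bd\<close> is
    what allows the norm to pass inside the series.\<close>
  then have "norm ((1 - q) * I - y m) \<le> M * (b - a) * C"
    unfolding sums_unique [OF dev] sums_unique [OF bd]
    by (rule norm_suminf_le [OF _ sums_summable [OF bd]])
  moreover have "1 / (b - a) * q_integral q a b f = (1 - q) * I"
    using \<open>a < b\<close> by (simp add: q_integral_def I_def y_def)
  ultimately show ?thesis
    by (simp add: y_def C_def abs_minus_commute mult_ac)
qed

text \<open>This \<open>f\<close> vanishes at x_m and attains the Lipschitz bound with
  \<open>M\<close> = 1 between x_m and every grid point, so no term of the estimate loses
  anything.\<close>

lemma q_Ostrowski_equality:
  fixes q a b :: real and m :: nat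
  defines "f \<equiv> \<lambda>t. \<bar>t - (a + q ^ m * (b - a))\<bar>"
  assumes q: "0 < q" "q < 1" and "a < b"
  shows "q_integrable q a b f"
    and "sup_norm_Ioc a b (q_deriv q a f) = 1"
    and "\<bar>f (a + q ^ m * (b - a)) - 1 / (b - a) * q_integral q a b f\<bar>
           = (b - a) * ((1 + 2 * q ^ (2 * m + 1)) / (1 + q) - q ^ m)"
proof -
  define C where "C = (1 + 2 * q ^ (2 * m + 1)) / (1 + q) - q ^ m"
  have f_grid: "f (a + q ^ k * (b - a)) = (b - a) * \<bar>q ^ k - q ^ m\<bar>" for k
    using \<open>a < b\<close> by (simp add: f_def abs_mult flip: left_diff_distrib)
  have "(\<lambda>k. (b - a) / (1 - q) * ((1 - q) * q ^ k * \<bar>q ^ k - q ^ m\<bar>)) sums ((b - a) / (1 - q) * C)"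
    unfolding C_def by (intro sums_mult sums_weighted_grid_distance q)
  moreover have "(b - a) / (1 - q) * ((1 - q) * q ^ k * \<bar>q ^ k - q ^ m\<bar>)
      = q ^ k * f (a + q ^ k * (b - a))" for k
    using q by (simp add: f_grid)
  ultimately have sums: "(\<lambda>k. q ^ k * f (a + q ^ k * (b - a))) sums ((b - a) / (1 - q) * C)"
    by simp
  then show "q_integrable q a b f"
    unfolding q_integrable_def by (rule sums_summable)
  have "q_integral q a b f = (b - a) * ((b - a) * C)"
    using q unfolding q_integral_def sums_unique [OF sums, symmetric] by simp
  moreover have "0 < C"
    unfolding C_def using q by (rule ostrowski_constant_pos)
  ultimately show "\<bar>f (a + q ^ m * (b - a)) - 1 / (b - a) * q_integral q a b f\<bar>
      = (b - a) * ((1 + 2 * q ^ (2 * m + 1)) / (1 + q) - q ^ m)"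
    using \<open>a < b\<close> unfolding C_def [symmetric] by (simp add: f_grid)
  have le: "\<bar>q_deriv q a f x\<bar> \<le> 1" if "x \<in> {a<..b}" for x
  proof -
    \<comment> \<open>Reverse triangle inequality: a distance function is 1-Lipschitz.\<close>
    have "\<bar>f x - f (a + q * (x - a))\<bar> \<le> \<bar>x - (a + q * (x - a))\<bar>"
      unfolding f_def by linarith
    also have "x - (a + q * (x - a)) = (1 - q) * (x - a)"
      by (simp add: algebra_simps)
    finally show ?thesis
      using that q by (simp add: q_deriv_def abs_mult)
  qed
  have at_b: "\<bar>q_deriv q a f b\<bar> = 1"
  proof -
    have "f b - f (a + q * (b - a)) = (b - a) * (\<bar>1 - q ^ m\<bar> - \<bar>q - q ^ m\<bar>)"
      using f_grid [of 0] f_grid [of 1] by (simp add: right_diff_distrib)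
    \<comment> \<open>The kink x_m is never strictly between x_0 = b and x_1: it is b itself for
      \<open>m\<close> = 0 and at most x_1 otherwise. Hence \<open>f\<close> has slope -1 or 1 on
      that whole step.\<close>
    moreover have "\<bar>\<bar>1 - q ^ m\<bar> - \<bar>q - q ^ m\<bar>\<bar> = 1 - q"
    proof (cases m)
      case 0
      then show ?thesis using q by simp
    next
      case (Suc n)
      have "q ^ m \<le> q ^ 1"
        using q Suc by (intro power_decreasing) auto
      then show ?thesis
        using q by simp
    qed
    ultimately show ?thesis
      using q \<open>a < b\<close> by (simp add: q_deriv_def abs_mult)
  qed
  show "sup_norm_Ioc a b (q_deriv q a f) = 1"
    unfolding sup_norm_Ioc_def
  proof (rule antisym)
    show "(SUP t\<in>{a<..b}. ereal \<bar>q_deriv q a f t\<bar>) \<le> 1"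
      using le by (intro SUP_least) (simp add: one_ereal_def)
    show "1 \<le> (SUP t\<in>{a<..b}. ereal \<bar>q_deriv q a f t\<bar>)"
      using at_b \<open>a < b\<close> by (intro SUP_upper2 [of b]) (auto simp: one_ereal_def)
  qed
qed

theorem theorem10:
  fixes q a b :: real and m :: nat
  assumes "0 < q" and "q < 1" and "a < b"
  shows "(\<forall>f :: real \<Rightarrow> real. q_integrable q a b f \<longrightarrow>
            ereal \<bar>f (a + q ^ m * (b - a)) - 1 / (b - a) * q_integral q a b f\<bar>
              \<le> ereal ((b - a) * ((1 + 2 * q ^ (2 * m + 1)) / (1 + q) - q ^ m))
                  * sup_norm_Ioc a b (q_deriv q a f)) \<and>
         (\<exists>f :: real \<Rightarrow> real. q_integrable q a b f \<and>
            0 < sup_norm_Ioc a b (q_deriv q a f) \<and>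
            sup_norm_Ioc a b (q_deriv q a f) < \<infinity> \<and>
            ereal \<bar>f (a + q ^ m * (b - a)) - 1 / (b - a) * q_integral q a b f\<bar>
              = ereal ((b - a) * ((1 + 2 * q ^ (2 * m + 1)) / (1 + q) - q ^ m))
                  * sup_norm_Ioc a b (q_deriv q a f))"
proof (intro conjI allI impI)
  note q = assms(1,2) and ab = assms(3)
  define C where "C = (b - a) * ((1 + 2 * q ^ (2 * m + 1)) / (1 + q) - q ^ m)"
  have "0 < C"
    unfolding C_def using ab ostrowski_constant_pos [OF q] by (intro mult_pos_pos) auto
  fix f :: "real \<Rightarrow> real"
  assume int: "q_integrable q a b f"
  define N where "N = sup_norm_Ioc a b (q_deriv q a f)"
  have upper: "ereal \<bar>q_deriv q a f x\<bar> \<le> N" if "x \<in> {a<..b}" for x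
    unfolding N_def sup_norm_Ioc_def using that by (rule SUP_upper)
  have "ereal \<bar>f (a + q ^ m * (b - a)) - 1 / (b - a) * q_integral q a b f\<bar> \<le> ereal C * N"
  \<comment> \<open>An infinite norm makes the right side infinite because \<open>C\<close> is
    positive; the value minus infinity is excluded since \<open>b\<close> belongs to the half-open
    interval.\<close>
  proof (cases N)
    case (real M)
    have "\<bar>f (a + q ^ m * (b - a)) - 1 / (b - a) * q_integral q a b f\<bar> \<le> C * M"
      unfolding C_def using upper real
      by (intro q_Ostrowski_inequality q ab int) simp
    then show ?thesis
      by (simp add: real)
  next
    case PInf
    then show ?thesis
      using \<open>0 < C\<close> by simp
  next
    case MInf
    then show ?thesis
      using upper [of b] ab by simp
  qed
  then show "ereal \<bar>f (a + q ^ m * (b - a)) - 1 / (b - a) * q_integral q a b f\<bar>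
      \<le> ereal ((b - a) * ((1 + 2 * q ^ (2 * m + 1)) / (1 + q) - q ^ m))
          * sup_norm_Ioc a b (q_deriv q a f)"
    by (simp only: C_def N_def)
next
  note eq = q_Ostrowski_equality [OF assms, of m]
  show "\<exists>f :: real \<Rightarrow> real. q_integrable q a b f \<and>
      0 < sup_norm_Ioc a b (q_deriv q a f) \<and>
      sup_norm_Ioc a b (q_deriv q a f) < \<infinity> \<and>
      ereal \<bar>f (a + q ^ m * (b - a)) - 1 / (b - a) * q_integral q a b f\<bar>
        = ereal ((b - a) * ((1 + 2 * q ^ (2 * m + 1)) / (1 + q) - q ^ m))
            * sup_norm_Ioc a b (q_deriv q a f)"
    \<comment> \<open>The witness stays schematic until \<open>eq(1)\<close> instantiates it;
      rewriting the norm to 1 then leaves trivial goals.\<close>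
    by (rule exI, intro conjI, rule eq(1), unfold eq(2,3)) auto
qed

end
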